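(* Let $G$ be a compact, totally disconnected, and metrizable topological group. Then $\mathrm{GKdim}(\mathcal{O}(G))=0$.
   Context: $\mathcal{O}(G)$ is the dense $*$-subalgebra of $C(G)$ generated by the matrix entries of irreducible unitary representations of $G$ (a unital $\mathbb{C}$-algebra). Gelfand–Kirillov dimension: for a unital algebra $\mathcal{A}$ over a field, let $\mathcal{V}$ be the set of all finite-dimensional subspaces of $\mathcal{A}$. For $V\in\mathcal{V}$ and $n\in\mathbb{N}_0$ let $V_n=\sum_{k=0}^nV^k$ be the subspace of elements expressible as sums of products of at most $n$ elements of $V$. Then $$\mathrm{GKdim}(\mathcal{A})=\sup_{V\in\mathcal{V}}\limsup_{n\to\infty}\frac{\log\dim(V_n)}{\log n}.$$ *)

theory Defs
  imports
    "HOL-Analysis.Analysis"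
    "HOL-Library.Function_Algebras"
    "Jordan_Normal_Form.Schur_Decomposition"
begin

section \<open>Unital algebras and Gelfand--Kirillov dimension\<close>

locale unital_algebra = vector_space scale
  for scale :: "'k::field \<Rightarrow> 'b::ring_1 \<Rightarrow> 'b" +
  assumes scale_mult_left: "scale c x * y = scale c (x * y)"
    and scale_mult_right: "x * scale c y = scale c (x * y)"
begin

definition subalgebra :: "'b set \<Rightarrow> bool" where
  "subalgebra A \<longleftrightarrow> local.subspace A \<and> 1 \<in> A \<and> (\<forall>x\<in>A. \<forall>y\<in>A. x * y \<in> A)"

definition fin_dim_subspaces :: "'b set \<Rightarrow> 'b set set" where
  "fin_dim_subspaces A = {V. local.subspace V \<and> V \<subseteq> A \<and> (\<exists>B. finite B \<and> local.span B = V)}"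

text \<open>The space \<open>V\<^sub>n = V\<^sup>0 + V\<^sup>1 + \<dots> + V\<^sup>n\<close>. The empty list contributes the unit, so \<open>V\<^sup>0\<close> is the
  space of scalars.\<close>

definition power_filtration :: "'b set \<Rightarrow> nat \<Rightarrow> 'b set" where
  "power_filtration V n = local.span {prod_list xs | xs. set xs \<subseteq> V \<and> length xs \<le> n}"

text \<open>Intended for \<open>A\<close> with \<open>subalgebra A\<close>; then \<open>V\<^sub>n\<close> is a subspace of \<open>A\<close>.\<close>

definition GKdim :: "'b set \<Rightarrow> ereal" where
  "GKdim A = (SUP V \<in> fin_dim_subspaces A.
     limsup (\<lambda>n. ereal (ln (real (local.dim (power_filtration V n))) / ln (real n))))"

end

global_interpretation fun_alg: unital_algebra "\<lambda>(c::complex) (f::'g \<Rightarrow> complex) x. c * f x"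
  defines fun_GKdim = fun_alg.GKdim
    and fun_subalgebra = fun_alg.subalgebra
  by unfold_locales (auto simp: fun_eq_iff algebra_simps)


section \<open>Unitary representations\<close>

text \<open>Groups are types of class \<^class>\<open>topological_group_add\<close>. The group law is written \<open>+\<close>, but
  this class does not assume commutativity.\<close>

definition unitary_mat :: "nat \<Rightarrow> complex mat \<Rightarrow> bool" where
  "unitary_mat n U \<longleftrightarrow> U \<in> carrier_mat n n \<and> mat_adjoint U * U = 1\<^sub>m n \<and> U * mat_adjoint U = 1\<^sub>m n"

text \<open>A continuous homomorphism from the group to the unitary group \<open>U(n)\<close>; continuity into
  matrices is continuity of all the entries. Representations are finite-dimensional, as is
  customary when speaking of the matrix entries of representations of a compact group.\<close>

definition unitary_rep :: "nat \<Rightarrow> ('g::topological_group_add \<Rightarrow> complex mat) \<Rightarrow> bool" where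
  "unitary_rep n \<rho> \<longleftrightarrow>
     (\<forall>g. unitary_mat n (\<rho> g)) \<and>
     (\<forall>g h. \<rho> (g + h) = \<rho> g * \<rho> h) \<and>
     (\<forall>i<n. \<forall>j<n. continuous_on UNIV (\<lambda>g. \<rho> g $$ (i, j)))"

definition irreducible_unitary_rep ::
    "nat \<Rightarrow> ('g::topological_group_add \<Rightarrow> complex mat) \<Rightarrow> bool" where
  "irreducible_unitary_rep n \<rho> \<longleftrightarrow>
     unitary_rep n \<rho> \<and> n > 0 \<and>
     (\<forall>W. VectorSpace.subspace class_ring W (module_vec TYPE(complex) n) \<and>
          (\<forall>g. \<forall>w\<in>W. \<rho> g *\<^sub>v w \<in> W)
        \<longrightarrow> W = {0\<^sub>v n} \<or> W = carrier_vec n)"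


section \<open>The algebra of representative functions\<close>

definition matrix_entries :: "('g::topological_group_add \<Rightarrow> complex) set" where
  "matrix_entries = {(\<lambda>g. \<rho> g $$ (i, j)) | \<rho> n i j.
     irreducible_unitary_rep n \<rho> \<and> i < n \<and> j < n}"

definition star_subalgebra :: "('g::topological_space \<Rightarrow> complex) set \<Rightarrow> bool" where
  "star_subalgebra A \<longleftrightarrow>
     fun_subalgebra A \<and> A \<subseteq> {f. continuous_on UNIV f} \<and> (\<forall>f\<in>A. (\<lambda>x. cnj (f x)) \<in> A)"

definition rep_algebra :: "('g::topological_group_add \<Rightarrow> complex) set" where
  "rep_algebra = star_subalgebra hull matrix_entries"

lemma star_subalgebra_continuous: "star_subalgebra {f. continuous_on UNIV f}"
  unfolding star_subalgebra_def fun_alg.subalgebra_def fun_alg.subspace_def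
  by (auto simp: plus_fun_def times_fun_def zero_fun_def one_fun_def intro!: continuous_intros)

lemma matrix_entries_continuous: "matrix_entries \<subseteq> {f. continuous_on UNIV f}"
  by (auto simp: matrix_entries_def irreducible_unitary_rep_def unitary_rep_def)

lemma star_subalgebra_rep_algebra: "star_subalgebra rep_algebra"
proof -
  have "rep_algebra \<subseteq> {f :: 'a \<Rightarrow> complex. continuous_on UNIV f}"
    unfolding rep_algebra_def
    by (rule hull_minimal[of _ "{f. continuous_on UNIV f}"])
      (rule matrix_entries_continuous star_subalgebra_continuous)+
  moreover have "f \<in> rep_algebra \<longleftrightarrow> (\<forall>A. star_subalgebra A \<and> matrix_entries \<subseteq> A \<longrightarrow> f \<in> A)"
    for f :: "'a \<Rightarrow> complex"
    by (auto simp: rep_algebra_def hull_def)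
  ultimately show ?thesis
    by (simp add: star_subalgebra_def fun_alg.subalgebra_def fun_alg.subspace_def)
qed


section \<open>Totally disconnected spaces\<close>

definition totally_disconnected :: "'a::topological_space set \<Rightarrow> bool" where
  "totally_disconnected S \<longleftrightarrow> (\<forall>x\<in>S. connected_component_set S x = {x})"

end

theory Submission
  imports Defs
begin

text \<open>A matrix close to the identity whose iterated squares all remain close to the identity is the
  identity, since squaring nearly doubles the distance \<open>A - 1\<close>. In a totally disconnected compact
  group, every neighbourhood of \<open>0\<close> contains a clopen \<open>U\<close>, and by compactness \<open>U + W \<subseteq> U\<close> for some
  neighbourhood \<open>W\<close> of \<open>0\<close>; all multiples of elements of \<open>W\<close> then stay in \<open>U\<close>. Hence a unitary
  representation is trivial on some \<open>W\<close>, so by compactness it has finite image. The continuous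
  functions with finite range therefore form a star subalgebra containing \<open>\<O>(G)\<close>. Finitely many
  such functions generate only functions that factor through one finite partition of \<open>G\<close>, so
  the dimensions of the \<open>V\<^sub>n\<close> are bounded.\<close>

section \<open>Matrices close to the identity\<close>

lemma square_closed_near_one_imp_one:
  fixes S :: "complex mat set"
  assumes S: "S \<subseteq> carrier_mat n n" and sq: "\<And>A. A \<in> S \<Longrightarrow> A * A \<in> S"
    and near: "\<And>A i j. A \<in> S \<Longrightarrow> i < n \<Longrightarrow> j < n \<Longrightarrow> cmod ((A - 1\<^sub>m n) $$ (i, j)) \<le> 1 / (2 * real n)"
    and A: "A \<in> S"
  shows "A = 1\<^sub>m n"
proof -
  \<comment> \<open>The induction treats all of \<open>S\<close> at once, because the step applies
    the hypothesis to \<open>A * A\<close> as well. With \<open>B = A - 1\<close> and entries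
    bounded by \<open>e\<close>, the identity \<open>2 B = (A * A - 1) - B * B\<close> gives
    \<open>(e + e/2) / 2\<close>, hence the factor \<open>3/4\<close>.\<close>
  have bound: "cmod ((A - 1\<^sub>m n) $$ (i, j)) \<le> (1 / (2 * real n)) * (3/4) ^ m"
    if "A \<in> S" "i < n" "j < n" for A i j m
    using that
  proof (induction m arbitrary: A i j)
    case 0
    then show ?case using near by simp
  next
    case (Suc m)
    define B where "B = A - 1\<^sub>m n"
    define e where "e = (1 / (2 * real n)) * (3/4) ^ m"
    have Ac: "A \<in> carrier_mat n n" using S Suc.prems by auto
    then have Bc: "B \<in> carrier_mat n n" unfolding B_def by (intro minus_carrier_mat) auto
    have n: "n > 0" using Suc.prems by simp
    have e0: "e \<ge> 0" "e \<le> 1 / (2 * real n)"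
      unfolding e_def by (auto intro!: mult_right_le_one_le power_le_one simp del: times_divide_eq_left mult_1)
    have B: "cmod (B $$ (k, l)) \<le> e" if "k < n" "l < n" for k l
      unfolding B_def e_def using Suc.IH[OF Suc.prems(1) that] .
    have AB: "A = B + 1\<^sub>m n" using Ac by (auto simp: B_def)
    have "A * A = B * B + B + (B + 1\<^sub>m n)"
      unfolding AB using Bc by (simp add: add_mult_distrib_mat[of _ n n] mult_add_distrib_mat[of _ n n])
    then have eq: "(A * A - 1\<^sub>m n) $$ (i, j) = (B * B) $$ (i, j) + 2 * B $$ (i, j)"
      using Suc.prems Bc by simp
    have "(B * B) $$ (i, j) = (\<Sum>k<n. B $$ (i, k) * B $$ (k, j))"
      using Suc.prems Bc by (simp add: scalar_prod_def atLeast0LessThan)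
    then have "cmod ((B * B) $$ (i, j)) \<le> (\<Sum>k<n. cmod (B $$ (i, k)) * cmod (B $$ (k, j)))"
      by (metis (no_types, lifting) norm_mult norm_sum sum.cong)
    also have "\<dots> \<le> (\<Sum>k<n. e * e)"
      using Suc.prems B e0 by (intro sum_mono mult_mono) auto
    also have "\<dots> = (real n * e) * e" by simp
    \<comment> \<open>The threshold \<open>1 / (2 * real n)\<close> makes
      \<open>real n * e \<le> 1/2\<close>, so the quadratic term costs at most half of
      \<open>e\<close>.\<close>
    also have "\<dots> \<le> (1 / 2) * e"
      using e0 n by (intro mult_right_mono) (auto simp: field_simps)
    finally have BB: "cmod ((B * B) $$ (i, j)) \<le> e / 2" by simp
    have "cmod ((A * A - 1\<^sub>m n) $$ (i, j)) \<le> e"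
      unfolding e_def using Suc.IH[OF sq] Suc.prems by simp
    moreover have "2 * B $$ (i, j) = (A * A - 1\<^sub>m n) $$ (i, j) - (B * B) $$ (i, j)"
      using eq by simp
    then have "2 * cmod (B $$ (i, j)) \<le> cmod ((A * A - 1\<^sub>m n) $$ (i, j)) + cmod ((B * B) $$ (i, j))"
      by (metis norm_mult norm_numeral norm_triangle_ineq4)
    ultimately have "cmod (B $$ (i, j)) \<le> 3 / 4 * e" using BB by simp
    then show ?case by (simp add: B_def e_def)
  qed
  have zero: "(A - 1\<^sub>m n) $$ (i, j) = 0" if "i < n" "j < n" for i j
  proof -
    have "(\<lambda>m. (1 / (2 * real n)) * (3/4) ^ m) \<longlonglongrightarrow> (1 / (2 * real n)) * 0"
      by (intro tendsto_mult_left LIMSEQ_realpow_zero) auto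
    then have "cmod ((A - 1\<^sub>m n) $$ (i, j)) \<le> (1 / (2 * real n)) * 0"
      by (rule LIMSEQ_le_const) (use bound[OF A that] in blast)
    then show ?thesis by simp
  qed
  have "A \<in> carrier_mat n n" using S A by auto
  then show ?thesis using zero by (intro eq_matI) auto
qed

section \<open>Compact spaces and topological groups\<close>

text \<open>By the cut-wire theorem, two closed sets in a compact Hausdorff space are separated by a
  clopen set if no connected set meets both. Here a connected set containing \<open>x\<close> is
  \<open>{x}\<close>, which misses \<open>- O'\<close>.\<close>

lemma clopen_neighbourhood:
  fixes x :: "'a::topological_space"
  assumes "compact (UNIV :: 'a set)" "Hausdorff_space (euclidean :: 'a topology)"
    and td: "totally_disconnected (UNIV :: 'a set)" and "open O'" "x \<in> O'"
  obtains U where "open U" "closed U" "x \<in> U" "U \<subseteq> O'"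
proof -
  have "separated_between euclidean {x} (- O')"
  proof (rule cut_wire_fence_theorem_gen)
    show "compact_space (euclidean :: 'a topology)" using assms by (simp add: compact_space_def)
    fix C :: "'a set" assume C: "connectedin euclidean C"
    have "C \<subseteq> {x}" if "x \<in> C"
    proof -
      have "C \<subseteq> connected_component_set UNIV x"
        using C that by (intro connected_component_maximal) auto
      then show ?thesis using td by (simp add: totally_disconnected_def)
    qed
    then show "disjnt C {x} \<or> disjnt C (- O')" using \<open>x \<in> O'\<close> by (auto simp: disjnt_def)
  qed (use assms in \<open>auto simp: closed_def\<close>)
  then obtain U V where UV: "open U" "open V" "U \<union> V = UNIV" "disjnt U V" "{x} \<subseteq> U" "- O' \<subseteq> V"
    by (auto simp: separated_between_def)
  then have "U = - V" by (auto simp: disjnt_def)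
  with UV that show thesis by (metis ComplI closed_Compl compl_le_swap2 insert_subset)
qed

lemma translation_stable_neighbourhood:
  fixes U :: "'g::topological_group_add set"
  assumes "compact U" "open U"
  obtains W where "open W" "0 \<in> W" "\<And>u w. u \<in> U \<Longrightarrow> w \<in> W \<Longrightarrow> u + w \<in> U"
proof -
  \<comment> \<open>The compact factor \<open>U\<close> comes second, as the tube lemma expects,
    while the sum keeps the order \<open>u + w\<close>, the group not being assumed
    commutative.\<close>
  let ?P = "(\<lambda>p::'g \<times> 'g. snd p + fst p) -` U"
  have "open ?P" using \<open>open U\<close> by (intro open_vimage continuous_intros)
  moreover have "{0} \<times> U \<subseteq> ?P" by auto
  ultimately have "\<exists>W. 0 \<in> W \<and> open W \<and> W \<times> U \<subseteq> ?P"
    by (rule Elementary_Topology.tube_lemma[OF \<open>compact U\<close>])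
  then obtain W where W: "0 \<in> W" "open W" "W \<times> U \<subseteq> ?P" by (elim exE conjE)
  have "u + w \<in> U" if "u \<in> U" "w \<in> W" for u w
    using subsetD[OF W(3), of "(w, u)"] that by simp
  with W(1,2) show thesis by (intro that[of W])
qed

text \<open>The function is constant on each translate \<open>g + W\<close>, and finitely many of
  these open sets cover the group.\<close>

lemma finite_range_if_right_locally_constant:
  fixes f :: "'g::topological_group_add \<Rightarrow> 'b"
  assumes "compact (UNIV :: 'g set)" "open W" "0 \<in> W"
    and inv: "\<And>g w. w \<in> W \<Longrightarrow> f (g + w) = f g"
  shows "finite (range f)"
proof -
  let ?C = "\<lambda>g. (\<lambda>x. - g + x) -` W"
  have "open (?C g)" for g using \<open>open W\<close> by (intro open_vimage continuous_intros)
  moreover have "UNIV \<subseteq> (\<Union>g. ?C g)" using \<open>0 \<in> W\<close> by auto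
  ultimately obtain D where D: "finite D" "UNIV \<subseteq> (\<Union>g\<in>D. ?C g)"
    by (rule compactE_image[OF assms(1), of UNIV ?C]) blast
  have "f x \<in> f ` D" for x
  proof -
    obtain g where "g \<in> D" "- g + x \<in> W" using D by auto
    then show ?thesis using inv[of "- g + x" g] by auto
  qed
  then show ?thesis using D by (meson finite_imageI finite_subset image_subsetI)
qed

section \<open>Finite image of unitary representations\<close>

lemma unitary_rep_zero:
  assumes "unitary_rep n \<rho>"
  shows "\<rho> 0 = 1\<^sub>m n"
proof -
  have c: "\<rho> 0 \<in> carrier_mat n n" and inv: "mat_adjoint (\<rho> 0) * \<rho> 0 = 1\<^sub>m n"
    and "\<rho> 0 * \<rho> 0 = \<rho> 0"
    using assms unfolding unitary_rep_def unitary_mat_def by (metis add.right_neutral)+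
  have "mat_adjoint (\<rho> 0) \<in> carrier_mat n n"
    using c by (auto simp: mat_adjoint_def)
  then have "mat_adjoint (\<rho> 0) * (\<rho> 0 * \<rho> 0) = (mat_adjoint (\<rho> 0) * \<rho> 0) * \<rho> 0"
    using c by (simp add: assoc_mult_mat[of _ n n _ n _ n])
  then show ?thesis using inv \<open>\<rho> 0 * \<rho> 0 = \<rho> 0\<close> c by simp
qed

lemma unitary_rep_finite_range:
  fixes \<rho> :: "'g::topological_group_add \<Rightarrow> complex mat"
  assumes "compact (UNIV :: 'g set)" "Hausdorff_space (euclidean :: 'g topology)"
    and "totally_disconnected (UNIV :: 'g set)" and \<rho>: "unitary_rep n \<rho>"
  shows "finite (range \<rho>)"
proof -
  let ?O = "\<Inter>i<n. \<Inter>j<n. {g. cmod (\<rho> g $$ (i, j) - 1\<^sub>m n $$ (i, j)) < 1 / (2 * real n)}"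
  have hom: "\<rho> (g + h) = \<rho> g * \<rho> h" and carrier: "\<rho> g \<in> carrier_mat n n" for g h
    using \<rho> by (auto simp: unitary_rep_def unitary_mat_def)
  have cont: "continuous_on UNIV (\<lambda>g. \<rho> g $$ (i, j))" if "i < n" "j < n" for i j
    using \<rho> that by (auto simp: unitary_rep_def)
  have "open ?O"
    by (intro open_INT finite_lessThan ballI open_Collect_less continuous_intros cont) auto
  moreover have "0 \<in> ?O" by (auto simp: unitary_rep_zero[OF \<rho>])
  ultimately obtain U where U: "open U" "closed U" "0 \<in> U" "U \<subseteq> ?O"
    by (rule clopen_neighbourhood[OF assms(1-3)])
  have "compact U" using U(2) assms(1) by (metis compact_Int_closed inf_top.left_neutral)
  from this U(1) obtain W where
    W: "open W" "0 \<in> W" "\<And>u w. u \<in> U \<Longrightarrow> w \<in> W \<Longrightarrow> u + w \<in> U"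
    by (rule translation_stable_neighbourhood) blast
  \<comment> \<open>\<open>W\<close> need not be closed under doubling. The stabilizer
    \<open>T\<close> of \<open>U\<close> under right translation is; it contains \<open>W\<close>
    and, since \<open>0 \<in> U\<close>, lies in \<open>U\<close>, where \<open>\<rho>\<close> is
    close to the identity.\<close>
  define T where "T = {g. \<forall>u\<in>U. u + g \<in> U}"
  have "T \<subseteq> U" using U(3) by (force simp: T_def)
  have TT: "g + g \<in> T" if "g \<in> T" for g
    using that by (simp add: T_def flip: add.assoc)
  have triv: "\<rho> w = 1\<^sub>m n" if "w \<in> W" for w
  proof (rule square_closed_near_one_imp_one[where S = "\<rho> ` T"])
    show "\<rho> ` T \<subseteq> carrier_mat n n" using carrier by auto
    show "A * A \<in> \<rho> ` T" if "A \<in> \<rho> ` T" for A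
      using that TT by (auto simp flip: hom)
    show "cmod ((A - 1\<^sub>m n) $$ (i, j)) \<le> 1 / (2 * real n)"
      if A: "A \<in> \<rho> ` T" and ij: "i < n" "j < n" for A i j
    proof -
      obtain g where "A = \<rho> g" "g \<in> U" using A \<open>T \<subseteq> U\<close> by blast
      then show ?thesis using U(4) ij by force
    qed
    show "\<rho> w \<in> \<rho> ` T" using W(3) that by (auto simp: T_def)
  qed
  show ?thesis
    using W(1,2) by (rule finite_range_if_right_locally_constant[OF assms(1)])
      (simp add: hom triv right_mult_one_mat[OF carrier])
qed

section \<open>Functions with finite range\<close>

lemma star_subalgebra_finite_range:
  "star_subalgebra {f :: 'g::topological_space \<Rightarrow> complex. continuous_on UNIV f \<and> finite (range f)}"
proof -
  have fin2: "finite (range (\<lambda>x. h (f x) (g x)))"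
    if "finite (range f)" "finite (range g)" for f g :: "'g \<Rightarrow> complex" and h :: "complex \<Rightarrow> complex \<Rightarrow> complex"
    by (rule finite_subset[of _ "(\<lambda>(a, b). h a b) ` (range f \<times> range g)"]) (use that in auto)
  have fin1: "finite (range (\<lambda>x. h (f x)))" if "finite (range f)" for f :: "'g \<Rightarrow> complex" and h :: "complex \<Rightarrow> complex"
    using fin2[OF that that, of "\<lambda>a b. h a"] .
  have sums: "finite (range (\<lambda>x. f x + g x))" and prods: "finite (range (\<lambda>x. f x * g x))"
    if "finite (range f)" "finite (range g)" for f g :: "'g \<Rightarrow> complex"
    using fin2[OF that, of "(+)"] fin2[OF that, of "(*)"] by auto
  have scales: "finite (range (\<lambda>x. c * f x))" and cnjs: "finite (range (\<lambda>x. cnj (f x)))"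
    if "finite (range f)" for f :: "'g \<Rightarrow> complex" and c
    using fin1[OF that, of "(*) c"] fin1[OF that, of cnj] by auto
  show ?thesis
    unfolding star_subalgebra_def fun_alg.subalgebra_def fun_alg.subspace_def
    by (auto simp: plus_fun_def times_fun_def zero_fun_def one_fun_def sums prods scales cnjs
        intro!: continuous_intros)
qed

lemma rep_algebra_finite_range:
  assumes "compact (UNIV :: 'g::topological_group_add set)"
    and "Hausdorff_space (euclidean :: 'g topology)" and "totally_disconnected (UNIV :: 'g set)"
    and "f \<in> (rep_algebra :: ('g \<Rightarrow> complex) set)"
  shows "finite (range f)"
proof -
  have "finite (range (\<lambda>g. \<rho> g $$ (i, j)))"
    if "irreducible_unitary_rep n \<rho>" for \<rho> :: "'g \<Rightarrow> complex mat" and n i j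
  proof -
    have "finite (range \<rho>)"
      using that by (auto simp: irreducible_unitary_rep_def intro: unitary_rep_finite_range[OF assms(1-3)])
    then show ?thesis using finite_imageI[of "range \<rho>" "\<lambda>A. A $$ (i, j)"] by (simp add: image_image)
  qed
  then have "(matrix_entries :: ('g \<Rightarrow> complex) set) \<subseteq> {f. continuous_on UNIV f \<and> finite (range f)}"
    using matrix_entries_continuous by (fastforce simp: matrix_entries_def)
  then have "rep_algebra \<subseteq> {f :: 'g \<Rightarrow> complex. continuous_on UNIV f \<and> finite (range f)}"
    unfolding rep_algebra_def by (rule hull_minimal) (rule star_subalgebra_finite_range)
  then show ?thesis using assms(4) by auto
qed

section \<open>Dimension bounds\<close>

text \<open>The indicator functions of the finitely many fibres of \<open>p\<close> serve as
  \<open>F\<close>.\<close>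

lemma factoring_functions_finite_dim:
  fixes p :: "'g \<Rightarrow> 'c"
  assumes "finite (range p)"
  obtains F where "finite F" "range (\<lambda>h x. h (p x)) \<subseteq> fun_alg.span F"
proof -
  let ?ind = "\<lambda>c (x::'g). if p x = c then 1 else (0::complex)"
  have "(\<lambda>x. h (p x)) \<in> fun_alg.span (?ind ` range p)" for h :: "'c \<Rightarrow> complex"
  proof -
    have sum_apply: "(\<Sum>c\<in>S. (\<lambda>x. h c * ?ind c x)) x = (\<Sum>c\<in>S. h c * ?ind c x)" for S x
      by (induction S rule: infinite_finite_induct) (simp_all add: zero_fun_def plus_fun_def)
    have "(\<Sum>c\<in>range p. h c * ?ind c x) = (\<Sum>c\<in>range p. if p x = c then h c else 0)" for x
      by (intro sum.cong) auto
    then have "(\<lambda>x. h (p x)) = (\<Sum>c\<in>range p. (\<lambda>x. h c * ?ind c x))"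
      using assms by (intro ext) (simp add: sum_apply)
    also have "\<dots> \<in> fun_alg.span (?ind ` range p)"
      by (intro fun_alg.span_sum fun_alg.span_scale fun_alg.span_base) auto
    finally show ?thesis .
  qed
  then show thesis using assms by (intro that[of "?ind ` range p"]) auto
qed

lemma power_filtration_dim_bounded:
  fixes B :: "('g \<Rightarrow> complex) set"
  assumes "finite B" and fin: "\<And>b. b \<in> B \<Longrightarrow> finite (range b)"
  obtains C where "\<And>n. fun_alg.dim (fun_alg.power_filtration (fun_alg.span B) n) \<le> C"
proof -
  \<comment> \<open>The joint value map of \<open>B\<close>: its fibres form the common partition,
    and each \<open>b\<close> is recovered as evaluation at \<open>b\<close>. Restricting to
    \<open>B\<close> puts the values in a finite product set.\<close>
  define p where "p = (\<lambda>x. restrict (\<lambda>b. b x) B)"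
  let ?E = "range (\<lambda>h x. h (p x)) :: ('g \<Rightarrow> complex) set"
  have "range p \<subseteq> Pi\<^sub>E B range" by (auto simp: p_def)
  then have "finite (range p)"
    using finite_PiE[OF assms] by (rule finite_subset)
  then obtain F where F: "finite F" "?E \<subseteq> fun_alg.span F"
    by (rule factoring_functions_finite_dim)
  have E: "fun_alg.subspace ?E"
  proof (rule fun_alg.subspaceI)
    show "0 \<in> ?E" by (rule range_eqI[of _ _ "\<lambda>_. 0"]) (simp add: zero_fun_def)
    show "f + g \<in> ?E" if fg: "f \<in> ?E" "g \<in> ?E" for f g
    proof -
      obtain h k where "f = (\<lambda>x. h (p x))" "g = (\<lambda>x. k (p x))" using fg by blast
      then show ?thesis
        by (intro range_eqI[of _ _ "\<lambda>q. h q + k q"]) (simp add: plus_fun_def)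
    qed
    show "(\<lambda>x. c * f x) \<in> ?E" if f: "f \<in> ?E" for c f
    proof -
      obtain h where "f = (\<lambda>x. h (p x))" using f by blast
      then show ?thesis by (intro range_eqI[of _ _ "\<lambda>q. c * h q"]) simp
    qed
  qed
  have "b \<in> ?E" if "b \<in> B" for b
    using that by (intro range_eqI[of _ _ "\<lambda>q. q b"]) (simp add: p_def)
  then have BE: "fun_alg.span B \<subseteq> ?E" using E by (intro fun_alg.span_minimal subsetI)
  \<comment> \<open>Closure of \<open>?E\<close> under products of any length makes the bound
    independent of \<open>n\<close>.\<close>
  have prods: "prod_list xs \<in> ?E" if "set xs \<subseteq> ?E" for xs
    using that
  proof (induction xs)
    case Nil
    show ?case by (rule range_eqI[of _ _ "\<lambda>_. 1"]) (simp add: one_fun_def)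
  next
    case (Cons f xs)
    then have "f \<in> ?E" "prod_list xs \<in> ?E" by simp_all
    then obtain h k where "f = (\<lambda>x. h (p x))" "prod_list xs = (\<lambda>x. k (p x))" by blast
    then show ?case
      by (intro range_eqI[of _ _ "\<lambda>q. h q * k q"]) (simp add: times_fun_def)
  qed
  have "fun_alg.power_filtration (fun_alg.span B) n \<subseteq> ?E" for n
    unfolding fun_alg.power_filtration_def
    by (rule fun_alg.span_minimal[OF _ E]) (use BE prods in blast)
  then show thesis
    using F by (intro that[of "card F"] fun_alg.dim_le_card) (rule order_trans)
qed

lemma limsup_log_bounded_eq_0:
  assumes "\<And>n. d n \<le> (C :: nat)"
  shows "limsup (\<lambda>n. ereal (ln (real (d n)) / ln (real n))) = 0"
proof (rule lim_imp_Limsup)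
  \<comment> \<open>\<open>Suc C\<close> is at least 1, so the bound is nonnegative and also covers
    \<open>d n = 0\<close>, where \<open>ln 0 = 0\<close>.\<close>
  have up: "ln (real (d n)) \<le> ln (real (Suc C))" for n
    using assms[of n] by (cases "d n = 0") auto
  have lim: "(\<lambda>n. ln (real (Suc C)) / ln (real n)) \<longlonglongrightarrow> 0"
    by (intro tendsto_divide_0[OF tendsto_const] filterlim_at_top_imp_at_infinity
        filterlim_compose[OF ln_at_top filterlim_real_sequentially])
  have "(\<lambda>n. ln (real (d n)) / ln (real n)) \<longlonglongrightarrow> 0"
  proof (rule tendsto_sandwich[OF _ _ tendsto_const lim])
    \<comment> \<open>Since \<open>ln 0 = 0\<close> and division by zero gives 0, both comparisons
      hold for every \<open>n\<close>, including 0 and 1.\<close>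
    have nonneg: "ln (real m) \<ge> 0" for m by (cases "m = 0") auto
    show "\<forall>\<^sub>F n in sequentially. 0 \<le> ln (real (d n)) / ln (real n)"
      using nonneg by simp
    show "\<forall>\<^sub>F n in sequentially. ln (real (d n)) / ln (real n) \<le> ln (real (Suc C)) / ln (real n)"
      by (intro always_eventually allI divide_right_mono up nonneg)
  qed
  then show "(\<lambda>n. ereal (ln (real (d n)) / ln (real n))) \<longlonglongrightarrow> 0"
    by (simp add: zero_ereal_def)
qed simp

text \<open>A finite spanning set of \<open>V\<close> lies in \<open>A\<close>, so its members have
  finite range and the dimension bound makes every term of the supremum 0.\<close>

lemma GKdim_finite_range_eq_0:
  assumes "fun_subalgebra A" and fin: "\<And>f. f \<in> A \<Longrightarrow> finite (range f)"
  shows "fun_GKdim A = 0"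
proof -
  have "limsup (\<lambda>n. ereal (ln (real (fun_alg.dim (fun_alg.power_filtration V n))) / ln (real n))) = 0"
    if V: "V \<in> fun_alg.fin_dim_subspaces A" for V
  proof -
    obtain B where B: "finite B" "fun_alg.span B = V" "V \<subseteq> A"
      using V by (auto simp: fun_alg.fin_dim_subspaces_def)
    then have "finite (range b)" if "b \<in> B" for b
      using that fin fun_alg.span_superset by blast
    with B(1) obtain C where "\<And>n. fun_alg.dim (fun_alg.power_filtration V n) \<le> C"
      using power_filtration_dim_bounded B(2) by metis
    then show ?thesis by (rule limsup_log_bounded_eq_0)
  qed
  \<comment> \<open>The index set must be nonempty, as an empty supremum in \<open>ereal\<close>
    would be minus infinity.\<close>
  moreover have "{0} \<in> fun_alg.fin_dim_subspaces A"
    using assms(1) unfolding fun_alg.fin_dim_subspaces_def fun_alg.subalgebra_def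
    by (auto simp: fun_alg.subspace_0 intro!: exI[of _ "{}"])
  ultimately show ?thesis unfolding fun_alg.GKdim_def by (subst SUP_eq_const) auto
qed

theorem corollary3p13:
  assumes "compact (UNIV :: 'g::topological_group_add set)"
    and "totally_disconnected (UNIV :: 'g set)"
    and "metrizable_space (euclidean :: 'g topology)"
  shows "fun_GKdim (rep_algebra :: ('g \<Rightarrow> complex) set) = 0"
proof (rule GKdim_finite_range_eq_0)
  show "fun_subalgebra (rep_algebra :: ('g \<Rightarrow> complex) set)"
    using star_subalgebra_rep_algebra[where 'a = 'g] by (simp add: star_subalgebra_def)
  show "finite (range f)" if "f \<in> rep_algebra" for f :: "'g \<Rightarrow> complex"
    using rep_algebra_finite_range[OF assms(1) metrizable_imp_Hausdorff_space[OF assms(3)] assms(2) that] .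
qed

end
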